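(* Let $p>1$, $s\in(0,1)$, $\gamma_*>0$, let $E\subset\mathbb{R}^N$ be a bounded open set, and let $u\in\mathrm{DG}^{s,p}_-(E;\gamma_* )$ be non-negative in $K_R(x_o)\subset E$. There exists a constant $\eta\in(0,1)$ depending only on $\{s,p,N,\gamma_*\}$, such that $$\operatorname*{ess\,inf}_{K_{\frac12\varrho}(x_o)}u+\Big(\frac{\varrho}{R}\Big)^{\frac{sp}{p-1}}\mathrm{Tail}[u_-;K_R(x_o)]\ge\eta\Big(\frac{1}{|K_\varrho(x_o)|}\int_{K_\varrho(x_o)}u^{p-1}\,\mathrm{d}x\Big)^{\frac{1}{p-1}},$$ provided that $K_{2\varrho}(x_o)\subset K_R(x_o)$.
   Context: $K_R(x_o)$ denotes the ball in $\mathbb{R}^N$ of radius $R$ and center $x_o$; $v_\pm=\max\{\pm v,0\}$. The tail is $$\mathrm{Tail}[u;K_R(x_o)]:=\Big(R^{sp}\int_{\mathbb{R}^N\setminus K_R(x_o)}\frac{|u(x)|^{p-1}}{|x-x_o|^{N+sp}}\,\mathrm{d}x\Big)^{\frac{1}{p-1}}.$$ Definition (fractional DeGiorgi class). A measurable function $u:\mathbb{R}^N\to\mathbb{R}$ belongs to $\mathrm{DG}^{s,p}_-(E;\gamma_* )$ if $u\in W^{s,p}_{\rm loc}(E)$, $$\int_{\mathbb{R}^N}\frac{|u(x)|^{p-1}}{1+|x|^{N+sp}}\,\mathrm{d}x<\infty,$$ and for all concentric balls $K_r(x_o)\subset K_R(x_o)\subset E$ (with $r<R$) and every $k\in\mathbb{R}$,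 writing $w_\pm:=(u-k)_\pm$, $$\int_{K_r(x_o)}\int_{K_r(x_o)}\frac{|w_-(x)-w_-(y)|^p}{|x-y|^{N+sp}}\,\mathrm{d}y\,\mathrm{d}x+\int_{K_r(x_o)}\int_{\mathbb{R}^N}\frac{w_-(x)w_+^{p-1}(y)}{|x-y|^{N+sp}}\,\mathrm{d}y\,\mathrm{d}x$$ $$\le\frac{\gamma_*R^{(1-s)p}}{(R-r)^p}\int_{K_R(x_o)}w_-^p\,\mathrm{d}x+\frac{\gamma_*R^N}{(R-r)^{N+sp}}\int_{K_R(x_o)}w_-\,\mathrm{d}x\,\big[\mathrm{Tail}[w_-;K_R(x_o)]\big]^{p-1}.$$ *)

theory Defs
  imports "HOL-Analysis.Analysis" "HOL-Probability.Essential_Supremum"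
begin

text \<open>
  All integrals below are integrals of nonnegative functions with respect to Lebesgue measure;
  they are taken in the extended nonnegative reals, so that no integrability assumption is
  hidden in the notation and a divergent integral has the value \<open>\<infinity>\<close>.
  The dimension \<open>N\<close> is \<open>CARD('n)\<close> and \<open>K\<^sub>R(x\<^sub>o)\<close> is the open ball
  \<open>ball x\<^sub>o R\<close>.
\<close>

definition pos_part :: "real \<Rightarrow> real" where
  "pos_part v = max v 0"

definition neg_part :: "real \<Rightarrow> real" where
  "neg_part v = max (- v) 0"

text \<open>Real powers of extended nonnegative reals; only used with exponents \<open>a > 0\<close>.\<close>

definition ennpowr :: "ennreal \<Rightarrow> real \<Rightarrow> ennreal" where
  "ennpowr x a = (if x = \<infinity> then \<infinity> else ennreal (enn2real x powr a))"

text \<open>Essential infimum over \<open>A\<close>, dual to the essential supremum of the library.\<close>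

definition essinf_on :: "(real ^ 'n) set \<Rightarrow> (real ^ 'n \<Rightarrow> real) \<Rightarrow> ereal" where
  "essinf_on A u = - esssup (lebesgue_on A) (\<lambda>x. - ereal (u x))"

definition Tail ::
  "real \<Rightarrow> real \<Rightarrow> (real ^ 'n \<Rightarrow> real) \<Rightarrow> real ^ 'n \<Rightarrow> real \<Rightarrow> ennreal" where
  "Tail s p u x\<^sub>o R =
     ennpowr
       (ennreal (R powr (s * p)) *
        (\<integral>\<^sup>+x\<in>- ball x\<^sub>o R.
            ennreal (\<bar>u x\<bar> powr (p - 1) / norm (x - x\<^sub>o) powr (real CARD('n) + s * p))
          \<partial>lebesgue))
       (1 / (p - 1))"

text \<open>
  The \<open>p\<close>-th power of the Gagliardo seminorm on \<open>A\<close>. On the diagonal the integrand is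
  \<open>0 / 0 = 0\<close>.
\<close>

definition gagliardo ::
  "real \<Rightarrow> real \<Rightarrow> (real ^ 'n) set \<Rightarrow> (real ^ 'n \<Rightarrow> real) \<Rightarrow> ennreal" where
  "gagliardo s p A u =
     (\<integral>\<^sup>+x\<in>A. (\<integral>\<^sup>+y\<in>A.
         ennreal (\<bar>u x - u y\<bar> powr p / norm (x - y) powr (real CARD('n) + s * p))
       \<partial>lebesgue) \<partial>lebesgue)"

definition frac_Sobolev ::
  "real \<Rightarrow> real \<Rightarrow> (real ^ 'n) set \<Rightarrow> (real ^ 'n \<Rightarrow> real) set" where
  "frac_Sobolev s p A =
     {u. u \<in> borel_measurable (lebesgue_on A) \<and>
         (\<integral>\<^sup>+x\<in>A. ennreal (\<bar>u x\<bar> powr p) \<partial>lebesgue) < \<infinity> \<and>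
         gagliardo s p A u < \<infinity>}"

definition frac_Sobolev_loc ::
  "real \<Rightarrow> real \<Rightarrow> (real ^ 'n) set \<Rightarrow> (real ^ 'n \<Rightarrow> real) set" where
  "frac_Sobolev_loc s p E =
     {u. \<forall>A. open A \<and> compact (closure A) \<and> closure A \<subseteq> E \<longrightarrow> u \<in> frac_Sobolev s p A}"

definition DG_minus ::
  "real \<Rightarrow> real \<Rightarrow> real \<Rightarrow> (real ^ 'n) set \<Rightarrow> (real ^ 'n \<Rightarrow> real) set" where
  "DG_minus s p \<gamma> E =
     {u. u \<in> borel_measurable lebesgue \<and>
         u \<in> frac_Sobolev_loc s p E \<and>
         (\<integral>\<^sup>+x. ennreal (\<bar>u x\<bar> powr (p - 1) / (1 + norm x powr (real CARD('n) + s * p)))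
           \<partial>lebesgue) < \<infinity> \<and>
         (\<forall>x\<^sub>o r R k. 0 < r \<and> r < R \<and> ball x\<^sub>o R \<subseteq> E \<longrightarrow>
           (let w_plus = (\<lambda>x. pos_part (u x - k));
                w_minus = (\<lambda>x. neg_part (u x - k))
            in
              gagliardo s p (ball x\<^sub>o r) w_minus
              + (\<integral>\<^sup>+x\<in>ball x\<^sub>o r. (\<integral>\<^sup>+y.
                    ennreal (w_minus x * w_plus y powr (p - 1)
                             / norm (x - y) powr (real CARD('n) + s * p))
                  \<partial>lebesgue) \<partial>lebesgue)
              \<le> ennreal (\<gamma> * R powr ((1 - s) * p) / (R - r) powr p)
                  * (\<integral>\<^sup>+x\<in>ball x\<^sub>o R. ennreal (w_minus x powr p) \<partial>lebesgue)
                + ennreal (\<gamma> * R ^ CARD('n) / (R - r) powr (real CARD('n) + s * p))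
                  * (\<integral>\<^sup>+x\<in>ball x\<^sub>o R. ennreal (w_minus x) \<partial>lebesgue)
                  * ennpowr (Tail s p w_minus x\<^sub>o R) (p - 1)))}"

end

theory Submission
  imports Defs
begin

text \<open>
  The proof rests on the mixed term
  \<open>\<integral>\<integral> w\<^sub>-(x) w\<^sub>+(y)\<^sup>p\<^sup>-\<^sup>1 |x-y|\<^sup>-\<^sup>N\<^sup>-\<^sup>s\<^sup>p\<close> on the left of the energy inequality.

  If \<open>u\<close> is nonnegative in \<open>K\<^sub>R\<close> and the rescaled tail of \<open>u\<^sub>-\<close> is at most of order \<open>k\<close>, then
  at every level \<open>h \<le> k\<close> the right-hand side of the energy inequality is a multiple of
  \<open>k\<^sup>p |{u < h}|\<close> (lemma \<open>DG_minus_mixed_energy_bound\<close>). The mixed term is then used twice.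

  \<^item> Far from the diagonal. On \<open>K\<^sub>\<rho>\<close> the kernel is at least \<open>(2\<rho>)\<^sup>-\<^sup>N\<^sup>-\<^sup>s\<^sup>p\<close>, so the mixed term dominates
    the product of \<open>\<integral> w\<^sub>-\<close> and \<open>\<integral> w\<^sub>+\<^sup>p\<^sup>-\<^sup>1\<close>. Hence if the mean of \<open>u\<^sup>p\<^sup>-\<^sup>1\<close> over \<open>K\<^sub>\<rho>\<close> is a large
    multiple of \<open>k\<^sup>p\<^sup>-\<^sup>1\<close>, the set where \<open>u < k/2\<close> fills only a small fraction of \<open>K\<^sub>\<rho>\<close>
    (lemma \<open>large_mean_imp_small_sublevel\<close>).

  \<^item> Near the diagonal. If the larger of two sublevel sets has measure at most \<open>|K\<^sub>t|/2\<close>, then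
    around each point \<open>x\<close> of the smaller one at least half of the ball of radius \<open>t\<close> lies where \<open>u\<close> is
    above the higher level, and the kernel contributes \<open>t\<^sup>-\<^sup>s\<^sup>p\<close> (lemma
    \<open>sublevel_mass_le_mixed_energy\<close>). Since \<open>t\<close> is comparable to the \<open>N\<close>-th root of the measure, this is
    exactly the gain of a power \<open>1 + sp/N\<close> that De Giorgi iteration needs, and a sufficiently small
    sublevel set forces \<open>u \<ge> k/2\<close> in half the ball (lemma \<open>De_Giorgi_lower_bound\<close>).

  The theorem follows by taking for \<open>k\<close> a fixed multiple of the \<open>(p-1)\<close>-mean of \<open>u\<close>: either the tail
  is itself at least a multiple of \<open>k\<close>, or both steps apply and \<open>u \<ge> k/4\<close> in \<open>K\<^sub>\<rho>\<^sub>/\<^sub>2\<close>.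
\<close>

section \<open>Elementary estimates\<close>

(* This rewrite rule expresses the measure of a set through its main part, after which
   the formula for the volume of a ball no longer applies. *)
declare emeasure_completion [simp del]

lemma powr_add_le:
  fixes a b q :: real
  assumes "0 \<le> a" "0 \<le> b" "0 < q"
  shows "(a + b) powr q \<le> 2 powr q * (a powr q + b powr q)"
proof -
  have "(a + b) powr q \<le> (2 * max a b) powr q"
    using assms by (intro powr_mono2) auto
  also have "\<dots> = 2 powr q * max a b powr q"
    using assms by (simp add: powr_mult)
  also have "\<dots> \<le> 2 powr q * (a powr q + b powr q)"
    by (intro mult_left_mono) (auto simp: max_def)
  finally show ?thesis .
qed

lemma ennpowr_inverse:
  assumes "0 < a"
  shows "ennpowr (ennpowr x (1 / a)) a = x"
  using assms by (cases x) (auto simp: ennpowr_def powr_powr)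

lemma borel_measurable_lebesgue_norm_diff [measurable]:
  "(\<lambda>y. norm (y - x0 :: 'a::euclidean_space)) \<in> borel_measurable lebesgue"
  "(\<lambda>y. norm (x0 - y :: 'a::euclidean_space)) \<in> borel_measurable lebesgue"
  by (auto intro!: measurable_completion)

lemma borel_measurable_lebesgue_norm [measurable]:
  "(\<lambda>y. norm (y :: 'a::euclidean_space)) \<in> borel_measurable lebesgue"
  by (auto intro!: measurable_completion)

lemma sublevel_in_ball_measurable:
  fixes u :: "'a::euclidean_space \<Rightarrow> real"
  assumes [measurable]: "u \<in> borel_measurable lebesgue"
  shows "{x \<in> ball x0 r. u x < h} \<in> sets lebesgue"
proof -
  have "ball x0 r \<inter> {x \<in> space lebesgue. u x < h} \<in> sets lebesgue"
    by (intro sets.Int) (simp, measurable)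
  also have "ball x0 r \<inter> {x \<in> space lebesgue. u x < h} = {x \<in> ball x0 r. u x < h}"
    by auto
  finally show ?thesis .
qed

lemma emeasure_lebesgue_ball:
  fixes c :: "real ^ 'n"
  assumes "0 \<le> r"
  shows "emeasure lebesgue (ball c r) = ennreal (unit_ball_vol (real CARD('n)) * r ^ CARD('n))"
  using emeasure_ball[OF assms, of c] by (simp add: emeasure_completion)

text \<open>
  The complement of the ball is cut into the annuli \<open>2\<^sup>j r \<le> |x - x0| < 2\<^sup>j\<^sup>+\<^sup>1 r\<close>. On the \<open>j\<close>-th one the
  kernel times the volume scales like \<open>2\<^sup>-\<^sup>j\<^sup>a r\<^sup>-\<^sup>a\<close>, which leaves a geometric series.
\<close>

lemma exterior_ball_integral:
  fixes a :: real
  assumes a: "0 < a"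
  shows "\<exists>C>0. \<forall>(x0 :: real ^ 'n) r. 0 < r \<longrightarrow>
    (\<integral>\<^sup>+x\<in>- ball x0 r. ennreal (1 / norm (x - x0) powr (real CARD('n) + a)) \<partial>lebesgue)
      \<le> ennreal (C * r powr (- a))"
proof -
  let ?N = "real CARD('n)" and ?\<omega> = "unit_ball_vol (real CARD('n))"
  define q where "q = 2 powr (- a)"
  have q: "0 < q" "q < 1"
    using a by (auto simp: q_def powr_less_one)
  define C where "C = ?\<omega> * 2 ^ CARD('n) * (1 / (1 - q))"
  have "0 < C" using q by (simp add: C_def)
  moreover have "(\<integral>\<^sup>+x\<in>- ball x0 r. ennreal (1 / norm (x - x0) powr (?N + a)) \<partial>lebesgue)
      \<le> ennreal (C * r powr (- a))" if r: "0 < r" for x0 :: "real ^ 'n" and r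
  proof -
    define c where "c j = 1 / (2 ^ j * r) powr (?N + a)" for j :: nat
    define B where "B j = ball x0 (2 ^ Suc j * r)" for j :: nat
    have [measurable]: "B j \<in> sets lebesgue" for j by (simp add: B_def)
    have pw: "ennreal (1 / norm (x - x0) powr (?N + a)) * indicator (- ball x0 r) x
        \<le> (\<Sum>j. ennreal (c j) * indicator (B j) x)" for x
    proof (cases "x \<in> ball x0 r")
      case False
      define n where "n = norm (x - x0)"
      have n: "r \<le> n" using False by (simp add: n_def dist_norm norm_minus_commute)
      have "\<exists>j. n / r < 2 ^ j" using real_arch_pow[of 2 "n / r"] by auto
      define m where "m = (LEAST j. n / r < 2 ^ j)"
      have m: "n / r < 2 ^ m" unfolding m_def using \<open>\<exists>j. n / r < 2 ^ j\<close> by (rule LeastI_ex)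
      have "m \<noteq> 0" using m n r by (auto intro!: gr0I simp: field_simps)
      then obtain j where j: "m = Suc j" by (cases m) auto
      have "\<not> n / r < 2 ^ j" using not_less_Least[of j "\<lambda>j. n / r < 2 ^ j"] j by (simp add: m_def)
      then have lo: "2 ^ j * r \<le> n" using r by (simp add: field_simps)
      have hi: "n < 2 ^ Suc j * r" using m r j by (simp add: field_simps)
      have "x \<in> B j" using hi by (simp add: B_def n_def dist_norm norm_minus_commute)
      have "0 < n" using n r by linarith
      then have "1 / n powr (?N + a) \<le> c j"
        unfolding c_def using lo r a by (intro divide_left_mono powr_mono2 mult_pos_pos) auto
      then have "ennreal (1 / n powr (?N + a)) \<le> ennreal (c j) * indicator (B j) x"
        using \<open>x \<in> B j\<close> by (simp add: ennreal_leI)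
      also have "\<dots> \<le> (\<Sum>j. ennreal (c j) * indicator (B j) x)"
        using sum_le_suminf[of "\<lambda>i. ennreal (c i) * indicator (B i) x" "{j}"]
        by (simp del: sum_mult_indicator)
      finally show ?thesis using False by (simp add: n_def)
    qed auto
    have annulus: "ennreal (c j) * emeasure lebesgue (B j)
        = ennreal (?\<omega> * 2 ^ CARD('n) * r powr (- a) * q ^ j)" for j
    proof -
      have "c j * (?\<omega> * (2 ^ Suc j * r) ^ CARD('n)) = ?\<omega> * 2 ^ CARD('n) * r powr (- a) * q ^ j"
      proof -
        have "(2 ^ j * r) powr (?N + a) = (2 ^ j * r) ^ CARD('n) * (2 ^ j * r) powr a"
          using r by (simp add: powr_add powr_realpow)
        moreover have "(2 ^ j * r) powr a = 1 / (r powr (- a) * q ^ j)"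
          using r by (simp add: powr_mult q_def powr_minus power_inverse field_simps
              powr_powr flip: powr_realpow) 
        ultimately have "c j = r powr (- a) * q ^ j / (2 ^ j * r) ^ CARD('n)"
          using r by (simp add: c_def)
        moreover have "(2 ^ Suc j * r) ^ CARD('n) = 2 ^ CARD('n) * (2 ^ j * r) ^ CARD('n)"
          by (simp add: power_mult_distrib)
        ultimately show ?thesis using r by (simp add: field_simps)
      qed
      moreover have "emeasure lebesgue (B j) = ennreal (?\<omega> * (2 ^ Suc j * r) ^ CARD('n))"
        unfolding B_def using r by (intro emeasure_lebesgue_ball) auto
      moreover have "0 \<le> c j" by (simp add: c_def)
      ultimately show ?thesis by (simp only: flip: ennreal_mult')
    qed
    have "(\<integral>\<^sup>+x\<in>- ball x0 r. ennreal (1 / norm (x - x0) powr (?N + a)) \<partial>lebesgue)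
        \<le> (\<integral>\<^sup>+x. (\<Sum>j. ennreal (c j) * indicator (B j) x) \<partial>lebesgue)"
      using pw by (intro nn_integral_mono)
    also have "\<dots> = (\<Sum>j. \<integral>\<^sup>+x. ennreal (c j) * indicator (B j) x \<partial>lebesgue)"
      by (intro nn_integral_suminf) auto
    also have "\<dots> = (\<Sum>j. ennreal (?\<omega> * 2 ^ CARD('n) * r powr (- a) * q ^ j))"
      by (simp add: nn_integral_cmult_indicator annulus)
    also have "\<dots> = ennreal (?\<omega> * 2 ^ CARD('n) * r powr (- a) * (1 / (1 - q)))"
      using q by (intro suminf_ennreal_eq sums_mult geometric_sums) auto
    finally show ?thesis by (simp add: C_def algebra_simps)
  qed
  ultimately show ?thesis by blast
qed

section \<open>The mixed energy of truncations\<close>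

definition mixed_energy ::
  "real \<Rightarrow> real \<Rightarrow> (real ^ 'n \<Rightarrow> real) \<Rightarrow> real \<Rightarrow> real ^ 'n \<Rightarrow> real \<Rightarrow> ennreal" where
  "mixed_energy s p u h x0 r =
     (\<integral>\<^sup>+x\<in>ball x0 r. (\<integral>\<^sup>+y.
         ennreal (neg_part (u x - h) * pos_part (u y - h) powr (p - 1)
                  / norm (x - y) powr (real CARD('n) + s * p))
       \<partial>lebesgue) \<partial>lebesgue)"

text \<open>
  What remains of the energy inequality for a function that is nonnegative and has a small tail:
  all truncation levels up to \<open>k\<close> and all concentric balls of radius at most \<open>S\<close> are admitted.
  The factor \<open>(r'/(r'-r))\<^sup>N\<^sup>+\<^sup>p\<close> absorbs both powers of \<open>1/(R-r)\<close> in the definition of the class.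
\<close>

definition mixed_energy_bound ::
  "real \<Rightarrow> real \<Rightarrow> real \<Rightarrow> (real ^ 'n \<Rightarrow> real) \<Rightarrow> real ^ 'n \<Rightarrow> real \<Rightarrow> real \<Rightarrow> bool" where
  "mixed_energy_bound C s p u x0 S k \<longleftrightarrow>
     (\<forall>h r r'. 0 < h \<and> h \<le> k \<and> 0 < r \<and> r < r' \<and> r' \<le> S \<longrightarrow>
        mixed_energy s p u h x0 r
        \<le> ennreal (C * (r' / (r' - r)) powr (real CARD('n) + p) * r' powr (- (s * p)) * k powr p)
          * emeasure lebesgue {x \<in> ball x0 r'. u x < h})"

lemma mixed_energy_boundD:
  fixes u :: "real ^ 'n \<Rightarrow> real"
  assumes "mixed_energy_bound C s p u x0 S k" and "0 < h" "h \<le> k" "0 < r" "r < r'" "r' \<le> S"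
  shows "mixed_energy s p u h x0 r
    \<le> ennreal (C * (r' / (r' - r)) powr (real CARD('n) + p) * r' powr (- (s * p)) * k powr p)
      * emeasure lebesgue {x \<in> ball x0 r'. u x < h}"
  using assms unfolding mixed_energy_bound_def by blast

text \<open>
  The truncation satisfies \<open>(u - h)\<^sub>- \<le> k + u\<^sub>-\<close>, and \<open>u\<^sub>-\<close> vanishes in \<open>K\<^sub>R\<close>. The constant \<open>k\<close> contributes
  the exterior integral of the kernel. The contribution of \<open>u\<^sub>-\<close> lives outside \<open>K\<^sub>R\<close> and is the tail of
  \<open>u\<^sub>-\<close> rescaled from \<open>R\<close> to \<open>r\<close>.
\<close>

lemma tail_truncation:
  fixes s p :: real
  assumes p: "1 < p" and s: "0 < s"
  shows "\<exists>C>0. \<forall>(u :: real ^ 'n \<Rightarrow> real) x0 r S R h k.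
    u \<in> borel_measurable lebesgue \<and> (AE x in lebesgue. x \<in> ball x0 R \<longrightarrow> 0 \<le> u x) \<and>
    0 < r \<and> r \<le> S \<and> S \<le> R \<and> 0 < h \<and> h \<le> k \<and>
    ennreal ((S / R) powr (s * p)) * ennpowr (Tail s p (\<lambda>x. neg_part (u x)) x0 R) (p - 1)
      \<le> ennreal (k powr (p - 1)) \<longrightarrow>
    ennpowr (Tail s p (\<lambda>x. neg_part (u x - h)) x0 r) (p - 1) \<le> ennreal (C * k powr (p - 1))"
proof -
  let ?N = "real CARD('n)"
  obtain C0 where C0: "0 < C0" and ext: "\<And>(x0 :: real ^ 'n) r. 0 < r \<Longrightarrow>
      (\<integral>\<^sup>+x\<in>- ball x0 r. ennreal (1 / norm (x - x0) powr (?N + s * p)) \<partial>lebesgue)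
        \<le> ennreal (C0 * r powr (- (s * p)))"
    using exterior_ball_integral[of "s * p", where ?'n = 'n] p s by auto
  let ?c = "2 powr (p - 1)"
  define C where "C = ?c * (C0 + 1)"
  have "0 < C" using C0 by (simp add: C_def)
  moreover have "ennpowr (Tail s p (\<lambda>x. neg_part (u x - h)) x0 r) (p - 1) \<le> ennreal (C * k powr (p - 1))"
    if [measurable]: "u \<in> borel_measurable lebesgue"
      and nonneg: "AE x in lebesgue. x \<in> ball x0 R \<longrightarrow> 0 \<le> u x"
      and r: "0 < r" "r \<le> S" "S \<le> R" and h: "0 < h" "h \<le> k"
      and tail: "ennreal ((S / R) powr (s * p)) * ennpowr (Tail s p (\<lambda>x. neg_part (u x)) x0 R) (p - 1)
        \<le> ennreal (k powr (p - 1))"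
    for u :: "real ^ 'n \<Rightarrow> real" and x0 r S R h k
  proof -
    let ?K = "\<lambda>x. norm (x - x0) powr (?N + s * p)"
    let ?I = "\<integral>\<^sup>+x\<in>- ball x0 R. ennreal (\<bar>neg_part (u x)\<bar> powr (p - 1) / ?K x) \<partial>lebesgue"
    let ?J = "\<integral>\<^sup>+x\<in>- ball x0 r. ennreal (\<bar>neg_part (u x - h)\<bar> powr (p - 1) / ?K x) \<partial>lebesgue"
    have [measurable]: "(\<lambda>x. neg_part (u x)) \<in> borel_measurable lebesgue"
      by (simp add: neg_part_def)
    have [measurable]: "- ball x0 t \<in> sets lebesgue" for t
      by simp
    have "AE x in lebesgue. ennreal (\<bar>neg_part (u x - h)\<bar> powr (p - 1) / ?K x) * indicator (- ball x0 r) x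
        \<le> ennreal (?c * k powr (p - 1)) * (ennreal (1 / ?K x) * indicator (- ball x0 r) x)
          + ennreal ?c * (ennreal (\<bar>neg_part (u x)\<bar> powr (p - 1) / ?K x) * indicator (- ball x0 R) x)"
      using nonneg
    proof eventually_elim
      case (elim x)
      show ?case
      proof (cases "x \<in> ball x0 r")
        case False
        define n where "n = (if x \<in> ball x0 R then 0 else neg_part (u x))"
        have n: "0 \<le> n" "\<bar>neg_part (u x - h)\<bar> \<le> k + n"
          using elim h by (auto simp: n_def neg_part_def)
        have "\<bar>neg_part (u x - h)\<bar> powr (p - 1) \<le> (k + n) powr (p - 1)"
          using n p by (intro powr_mono2) auto
        also have "\<dots> \<le> ?c * (k powr (p - 1) + n powr (p - 1))"
          using n p h by (intro powr_add_le) auto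
        finally have "\<bar>neg_part (u x - h)\<bar> powr (p - 1) / ?K x
            \<le> ?c * (k powr (p - 1) + n powr (p - 1)) / ?K x"
          by (intro divide_right_mono) auto
        then have "ennreal (\<bar>neg_part (u x - h)\<bar> powr (p - 1) / ?K x)
            \<le> ennreal (?c * k powr (p - 1) * (1 / ?K x) + ?c * (n powr (p - 1) / ?K x))"
          by (intro ennreal_leI) (simp add: algebra_simps add_divide_distrib)
        also have "\<dots> = ennreal (?c * k powr (p - 1)) * ennreal (1 / ?K x)
            + ennreal ?c * ennreal (n powr (p - 1) / ?K x)"
          by (subst ennreal_plus) (simp_all flip: ennreal_mult)
        also have "ennreal (n powr (p - 1) / ?K x)
            = ennreal (\<bar>neg_part (u x)\<bar> powr (p - 1) / ?K x) * indicator (- ball x0 R) x"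
          by (auto simp: n_def neg_part_def)
        finally show ?thesis using False by simp
      qed auto
    qed
    then have "?J \<le> (\<integral>\<^sup>+x. ennreal (?c * k powr (p - 1)) * (ennreal (1 / ?K x) * indicator (- ball x0 r) x)
          + ennreal ?c * (ennreal (\<bar>neg_part (u x)\<bar> powr (p - 1) / ?K x) * indicator (- ball x0 R) x) \<partial>lebesgue)"
      by (rule nn_integral_mono_AE)
    also have "\<dots> = ennreal (?c * k powr (p - 1)) *
          (\<integral>\<^sup>+x\<in>- ball x0 r. ennreal (1 / ?K x) \<partial>lebesgue) + ennreal ?c * ?I"
      by (subst nn_integral_add, measurable, subst (1 2) nn_integral_cmult, measurable)
    also have "\<dots> \<le> ennreal (?c * k powr (p - 1)) * ennreal (C0 * r powr (- (s * p))) + ennreal ?c * ?I"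
      using ext[OF r(1)] by (intro add_mono mult_left_mono) auto
    finally have J: "?J \<le> ennreal (?c * k powr (p - 1)) * ennreal (C0 * r powr (- (s * p))) + ennreal ?c * ?I" .
    have "ennreal (r powr (s * p)) * ?I \<le> ennreal (S powr (s * p)) * ?I"
      using r p s by (intro mult_right_mono ennreal_leI powr_mono2) auto
    also have "\<dots> = ennreal ((S / R) powr (s * p)) * (ennreal (R powr (s * p)) * ?I)"
      using r by (simp add: powr_divide flip: mult.assoc ennreal_mult)
    also have "\<dots> \<le> ennreal (k powr (p - 1))"
      using tail p by (simp add: Tail_def ennpowr_inverse)
    finally have I: "ennreal (r powr (s * p)) * ?I \<le> ennreal (k powr (p - 1))" .
    have "ennpowr (Tail s p (\<lambda>x. neg_part (u x - h)) x0 r) (p - 1) = ennreal (r powr (s * p)) * ?J"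
      using p by (simp add: Tail_def ennpowr_inverse)
    also have "\<dots> \<le> ennreal (r powr (s * p)) *
        (ennreal (?c * k powr (p - 1)) * ennreal (C0 * r powr (- (s * p))) + ennreal ?c * ?I)"
      using J by (rule mult_left_mono) simp
    also have "\<dots> = ennreal (r powr (s * p) * (?c * k powr (p - 1) * (C0 * r powr (- (s * p)))))
        + ennreal ?c * (ennreal (r powr (s * p)) * ?I)"
      using C0 by (simp add: ennreal_mult algebra_simps)
    also have "r powr (s * p) * (?c * k powr (p - 1) * (C0 * r powr (- (s * p)))) = ?c * C0 * k powr (p - 1)"
      using r by (simp add: powr_minus field_simps)
    also have "ennreal (?c * C0 * k powr (p - 1)) + ennreal ?c * (ennreal (r powr (s * p)) * ?I)
        \<le> ennreal (?c * C0 * k powr (p - 1)) + ennreal ?c * ennreal (k powr (p - 1))"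
      using I by (intro add_mono mult_left_mono) auto
    also have "\<dots> = ennreal (C * k powr (p - 1))"
      using C0 by (simp add: C_def algebra_simps flip: ennreal_mult ennreal_plus)
    finally show ?thesis .
  qed
  ultimately show ?thesis by blast
qed

text \<open>
  In \<open>K\<^sub>R\<close> the truncation \<open>(u - h)\<^sub>-\<close> is at most \<open>k\<close> and supported in \<open>{u < h}\<close>, which bounds both
  integrals over the larger ball; the remaining factor is the tail of the truncation.
\<close>

lemma DG_minus_mixed_energy_bound:
  fixes s p \<gamma> :: real
  assumes p: "1 < p" and s: "0 < s" "s < 1" and \<gamma>: "0 < \<gamma>"
  shows "\<exists>C>0. \<forall>(E :: (real ^ 'n) set) u x0 S R k.
    u \<in> DG_minus s p \<gamma> E \<and> ball x0 R \<subseteq> E \<and> (AE x in lebesgue. x \<in> ball x0 R \<longrightarrow> 0 \<le> u x) \<and>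
    S \<le> R \<and>
    ennreal ((S / R) powr (s * p)) * ennpowr (Tail s p (\<lambda>x. neg_part (u x)) x0 R) (p - 1)
      \<le> ennreal (k powr (p - 1)) \<longrightarrow>
    mixed_energy_bound C s p u x0 S k"
proof -
  let ?N = "real CARD('n)"
  obtain C1 where C1: "0 < C1" and tail_le: "\<And>(u :: real ^ 'n \<Rightarrow> real) x0 r S R h k.
      u \<in> borel_measurable lebesgue \<Longrightarrow> (AE x in lebesgue. x \<in> ball x0 R \<longrightarrow> 0 \<le> u x) \<Longrightarrow>
      0 < r \<Longrightarrow> r \<le> S \<Longrightarrow> S \<le> R \<Longrightarrow> 0 < h \<Longrightarrow> h \<le> k \<Longrightarrow>
      ennreal ((S / R) powr (s * p)) * ennpowr (Tail s p (\<lambda>x. neg_part (u x)) x0 R) (p - 1)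
        \<le> ennreal (k powr (p - 1)) \<Longrightarrow>
      ennpowr (Tail s p (\<lambda>x. neg_part (u x - h)) x0 r) (p - 1) \<le> ennreal (C1 * k powr (p - 1))"
    using tail_truncation[OF p s(1), where ?'n = 'n] by blast
  define C where "C = \<gamma> * (1 + C1)"
  have "0 < C" using C1 \<gamma> by (simp add: C_def)
  moreover have "mixed_energy_bound C s p u x0 S k"
    if u: "u \<in> DG_minus s p \<gamma> E" and E: "ball x0 R \<subseteq> E"
      and nonneg: "AE x in lebesgue. x \<in> ball x0 R \<longrightarrow> 0 \<le> u x"
      and SR: "S \<le> R"
      and tail: "ennreal ((S / R) powr (s * p)) * ennpowr (Tail s p (\<lambda>x. neg_part (u x)) x0 R) (p - 1)
        \<le> ennreal (k powr (p - 1))"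
    for E :: "(real ^ 'n) set" and u x0 S R k
    unfolding mixed_energy_bound_def
  proof (intro allI impI)
    fix h r r' assume "0 < h \<and> h \<le> k \<and> 0 < r \<and> r < r' \<and> r' \<le> S"
    then have h: "0 < h" "h \<le> k" and r: "0 < r" "r < r'" "r' \<le> S" by auto
    have um [measurable]: "u \<in> borel_measurable lebesgue" using u by (simp add: DG_minus_def)
    let ?w = "\<lambda>x. neg_part (u x - h)"
    define A where "A = {x \<in> ball x0 r'. u x < h}"
    have [measurable]: "A \<in> sets lebesgue"
      unfolding A_def by (intro sublevel_in_ball_measurable um)
    have "ball x0 r' \<subseteq> ball x0 R" using r SR by (intro subset_ball) auto
    then have "ball x0 r' \<subseteq> E" using E by blast
    then have "gagliardo s p (ball x0 r) ?w + mixed_energy s p u h x0 r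
        \<le> ennreal (\<gamma> * r' powr ((1 - s) * p) / (r' - r) powr p)
            * (\<integral>\<^sup>+x\<in>ball x0 r'. ennreal (?w x powr p) \<partial>lebesgue)
          + ennreal (\<gamma> * r' ^ CARD('n) / (r' - r) powr (?N + s * p))
            * (\<integral>\<^sup>+x\<in>ball x0 r'. ennreal (?w x) \<partial>lebesgue)
            * ennpowr (Tail s p ?w x0 r') (p - 1)"
      using u r unfolding DG_minus_def mixed_energy_def Let_def by blast
    then have "mixed_energy s p u h x0 r
        \<le> ennreal (\<gamma> * r' powr ((1 - s) * p) / (r' - r) powr p)
            * (\<integral>\<^sup>+x\<in>ball x0 r'. ennreal (?w x powr p) \<partial>lebesgue)
          + ennreal (\<gamma> * r' ^ CARD('n) / (r' - r) powr (?N + s * p))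
            * (\<integral>\<^sup>+x\<in>ball x0 r'. ennreal (?w x) \<partial>lebesgue)
            * ennpowr (Tail s p ?w x0 r') (p - 1)"
      by (rule order_trans[rotated]) simp
    also have "\<dots> \<le> ennreal (\<gamma> * r' powr ((1 - s) * p) / (r' - r) powr p)
            * (ennreal (k powr p) * emeasure lebesgue A)
          + ennreal (\<gamma> * r' ^ CARD('n) / (r' - r) powr (?N + s * p))
            * (ennreal k * emeasure lebesgue A)
            * ennreal (C1 * k powr (p - 1))"
    proof -
      \<comment> \<open>Needed for both powers of the truncation on the right-hand side,
        \<open>f t = t powr p\<close> and \<open>f t = t\<close>.\<close>
      have "(\<integral>\<^sup>+x\<in>ball x0 r'. ennreal (f (?w x)) \<partial>lebesgue) \<le> ennreal (f k) * emeasure lebesgue A"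
        if f: "\<And>a b. 0 \<le> a \<Longrightarrow> a \<le> b \<Longrightarrow> f a \<le> f b" "f 0 = 0" for f :: "real \<Rightarrow> real"
      proof -
        have "AE x in lebesgue. ennreal (f (?w x)) * indicator (ball x0 r') x \<le> ennreal (f k) * indicator A x"
          using nonneg
        proof eventually_elim
          case (elim x)
          show ?case
          proof (cases "x \<in> ball x0 r'")
            case True
            then have "0 \<le> u x" using elim \<open>ball x0 r' \<subseteq> ball x0 R\<close> by blast
            then have "?w x \<le> k" "0 \<le> ?w x" using h by (auto simp: neg_part_def)
            then have "f (?w x) \<le> f k" by (intro f(1))
            then show ?thesis
              using True f(2) by (cases "u x < h") (auto simp: A_def neg_part_def ennreal_leI)
          qed auto
        qed
        then have "(\<integral>\<^sup>+x\<in>ball x0 r'. ennreal (f (?w x)) \<partial>lebesgue)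
            \<le> (\<integral>\<^sup>+x. ennreal (f k) * indicator A x \<partial>lebesgue)"
          by (rule nn_integral_mono_AE)
        then show ?thesis by (simp add: nn_integral_cmult_indicator)
      qed
      from this[of "\<lambda>t. t powr p"] this[of "\<lambda>t. t"]
      have "(\<integral>\<^sup>+x\<in>ball x0 r'. ennreal (?w x powr p) \<partial>lebesgue) \<le> ennreal (k powr p) * emeasure lebesgue A"
        "(\<integral>\<^sup>+x\<in>ball x0 r'. ennreal (?w x) \<partial>lebesgue) \<le> ennreal k * emeasure lebesgue A"
        using p powr_mono2[of p] by simp_all
      moreover have "ennpowr (Tail s p ?w x0 r') (p - 1) \<le> ennreal (C1 * k powr (p - 1))"
        using um nonneg r SR h tail by (intro tail_le[of u x0 R r' S h k]) auto
      ultimately show ?thesis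
        by (intro add_mono mult_mono mult_left_mono) auto
    qed
    also have "\<dots> = ennreal (\<gamma> * r' powr ((1 - s) * p) / (r' - r) powr p * k powr p
        + \<gamma> * r' ^ CARD('n) / (r' - r) powr (?N + s * p) * k * (C1 * k powr (p - 1))) * emeasure lebesgue A"
    proof -
      have "ennreal a * (ennreal b * m) + ennreal c * (ennreal d * m) * ennreal e
          = ennreal (a * b + c * d * e) * m"
        if "0 \<le> a" "0 \<le> b" "0 \<le> c" "0 \<le> d" "0 \<le> e" for a b c d e m
        using that by (simp add: ennreal_mult algebra_simps)
      then show ?thesis using \<gamma> r h C1 by simp
    qed
    also have "\<dots> \<le> ennreal (C * (r' / (r' - r)) powr (?N + p) * r' powr (- (s * p)) * k powr p) * emeasure lebesgue A"
    proof (intro mult_right_mono ennreal_leI)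
      define q where "q = r' / (r' - r)"
      have q: "1 \<le> q" using r by (simp add: q_def)
      have sp: "s * p \<le> p" using s p by simp
      have first: "r' powr ((1 - s) * p) / (r' - r) powr p = q powr p * r' powr (- (s * p))"
        using r by (simp add: q_def powr_divide left_diff_distrib powr_diff powr_minus field_simps)
      have second: "r' ^ CARD('n) / (r' - r) powr (?N + s * p) = q powr (?N + s * p) * r' powr (- (s * p))"
        using r by (simp add: q_def powr_divide powr_add powr_realpow powr_minus field_simps)
      have third: "k * k powr (p - 1) = k powr p"
        using h by (simp add: powr_diff)
      have "\<gamma> * r' powr ((1 - s) * p) / (r' - r) powr p * k powr p
          + \<gamma> * r' ^ CARD('n) / (r' - r) powr (?N + s * p) * k * (C1 * k powr (p - 1))
          = \<gamma> * (r' powr ((1 - s) * p) / (r' - r) powr p) * k powr p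
            + \<gamma> * C1 * (r' ^ CARD('n) / (r' - r) powr (?N + s * p)) * (k * k powr (p - 1))"
        by simp
      also have "\<dots> = (\<gamma> * q powr p + \<gamma> * C1 * q powr (?N + s * p)) * (r' powr (- (s * p)) * k powr p)"
        unfolding first second third by (simp add: algebra_simps)
      also have "\<dots> \<le> (\<gamma> * q powr (?N + p) + \<gamma> * C1 * q powr (?N + p)) * (r' powr (- (s * p)) * k powr p)"
        using q sp \<gamma> C1 by (intro mult_right_mono add_mono mult_left_mono powr_mono) auto
      also have "\<dots> = C * q powr (?N + p) * r' powr (- (s * p)) * k powr p"
        by (simp add: C_def algebra_simps)
      finally show "\<gamma> * r' powr ((1 - s) * p) / (r' - r) powr p * k powr p
          + \<gamma> * r' ^ CARD('n) / (r' - r) powr (?N + s * p) * k * (C1 * k powr (p - 1))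
          \<le> C * (r' / (r' - r)) powr (?N + p) * r' powr (- (s * p)) * k powr p"
        by (simp add: q_def)
    qed simp
    finally show "mixed_energy s p u h x0 r
        \<le> ennreal (C * (r' / (r' - r)) powr (?N + p) * r' powr (- (s * p)) * k powr p)
          * emeasure lebesgue {x \<in> ball x0 r'. u x < h}"
      by (simp add: A_def)
  qed
  ultimately show ?thesis by blast
qed

section \<open>De Giorgi iteration through the mixed energy\<close>

text \<open>
  This plays the part of the Sobolev inequality in the iteration. Truncate at the midpoint \<open>h\<close> of the two
  levels, so that both \<open>u < l\<close> and \<open>u \<ge> l'\<close> are at distance \<open>d = (l' - l)/2\<close> from \<open>h\<close>. For \<open>x\<close> in the
  smaller sublevel set, \<open>K\<^sub>t(x)\<close> is contained in \<open>K\<^sub>r\<^sub>'\<close>, hence at least half of it lies in \<open>{u \<ge> l'}\<close>; there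
  the kernel is at least \<open>t\<^sup>-\<^sup>N\<^sup>-\<^sup>s\<^sup>p\<close>.
\<close>

lemma sublevel_mass_le_mixed_energy:
  fixes u :: "real ^ 'n \<Rightarrow> real" and s p l l' t :: real
  assumes p: "1 < p" and sp: "0 \<le> s * p" and um: "u \<in> borel_measurable lebesgue"
    and l: "l < l'" and t: "0 < t" "t \<le> r' - r"
    and small: "emeasure lebesgue {x \<in> ball x0 r'. u x < l'}
      \<le> ennreal (unit_ball_vol (real CARD('n)) * t ^ CARD('n) / 2)"
  shows "ennreal (((l' - l) / 2) powr p * (unit_ball_vol (real CARD('n)) / 2 * t powr (- (s * p))))
      * emeasure lebesgue {x \<in> ball x0 r. u x < l}
    \<le> mixed_energy s p u ((l + l') / 2) x0 r"
proof -
  note [measurable] = um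
  let ?N = "real CARD('n)" and ?\<omega> = "unit_ball_vol (real CARD('n))"
  define d where "d = (l' - l) / 2"
  define h where "h = (l + l') / 2"
  define A A' where "A = {x \<in> ball x0 r. u x < l}" and "A' = {x \<in> ball x0 r'. u x < l'}"
  have [measurable]: "A \<in> sets lebesgue" "A' \<in> sets lebesgue"
    unfolding A_def A'_def by (intro sublevel_in_ball_measurable um)+
  have d: "0 < d" using l by (simp add: d_def)
  define c where "c = d powr p / t powr (?N + s * p)"
  have inner: "ennreal (d powr p * (?\<omega> / 2 * t powr (- (s * p)))) \<le>
      (\<integral>\<^sup>+y. ennreal (neg_part (u x - h) * pos_part (u y - h) powr (p - 1)
          / norm (x - y) powr (?N + s * p)) \<partial>lebesgue)" if x: "x \<in> A" for x
  proof -
    have "ball x t \<subseteq> ball x0 r'"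
    proof
      fix y assume "y \<in> ball x t"
      then show "y \<in> ball x0 r'"
        using x t dist_triangle[of x0 y x] by (auto simp: A_def)
    qed
    have vol: "emeasure lebesgue (ball x t) = ennreal (?\<omega> * t ^ CARD('n))"
      using t by (intro emeasure_lebesgue_ball) auto
    have "ennreal (?\<omega> * t ^ CARD('n) / 2) + ennreal (?\<omega> * t ^ CARD('n) / 2) = emeasure lebesgue (ball x t)"
      using t by (simp add: vol flip: ennreal_plus)
    also have "\<dots> \<le> emeasure lebesgue ((ball x t - A') \<union> A')"
      by (intro emeasure_mono) auto
    also have "\<dots> \<le> emeasure lebesgue (ball x t - A') + emeasure lebesgue A'"
      by (intro emeasure_subadditive) auto
    also have "\<dots> \<le> emeasure lebesgue (ball x t - A') + ennreal (?\<omega> * t ^ CARD('n) / 2)"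
      using small by (intro add_left_mono) (simp add: A'_def)
    finally have half: "ennreal (?\<omega> * t ^ CARD('n) / 2) \<le> emeasure lebesgue (ball x t - A')"
      by (simp add: ennreal_add_left_cancel_le)
    have "d powr p * (?\<omega> / 2 * t powr (- (s * p))) = c * (?\<omega> * t ^ CARD('n) / 2)"
      using t by (simp add: c_def powr_add powr_minus powr_realpow field_simps)
    then have "ennreal (d powr p * (?\<omega> / 2 * t powr (- (s * p)))) = ennreal c * ennreal (?\<omega> * t ^ CARD('n) / 2)"
      using t by (simp add: c_def flip: ennreal_mult)
    also have "\<dots> \<le> ennreal c * emeasure lebesgue (ball x t - A')"
      using half by (intro mult_left_mono) auto
    also have "\<dots> = (\<integral>\<^sup>+y. ennreal c * indicator (ball x t - A') y \<partial>lebesgue)"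
      by (intro nn_integral_cmult_indicator[symmetric]) auto
    also have "\<dots> \<le> (\<integral>\<^sup>+y. ennreal (neg_part (u x - h) * pos_part (u y - h) powr (p - 1)
          / norm (x - y) powr (?N + s * p)) \<partial>lebesgue)"
    proof (intro nn_integral_mono)
      fix y
      show "ennreal c * indicator (ball x t - A') y \<le> ennreal (neg_part (u x - h) * pos_part (u y - h) powr (p - 1)
          / norm (x - y) powr (?N + s * p))"
      proof (cases "y \<in> ball x t - A'")
        case True
        then have "l' \<le> u y" using \<open>ball x t \<subseteq> ball x0 r'\<close> by (auto simp: A'_def)
        moreover have "u x < l" using x by (simp add: A_def)
        \<comment> \<open>The points differ, so the quotient is not the default value of a division by zero.\<close>
        ultimately have w: "d \<le> neg_part (u x - h)" "d \<le> pos_part (u y - h)" "x \<noteq> y"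
          using l by (auto simp: neg_part_def pos_part_def d_def h_def field_simps)
        have "norm (x - y) \<le> t" using True by (simp add: dist_norm)
        have "c = d * d powr (p - 1) / t powr (?N + s * p)"
          using d by (simp add: c_def powr_diff)
        also have "\<dots> \<le> neg_part (u x - h) * pos_part (u y - h) powr (p - 1) / norm (x - y) powr (?N + s * p)"
          using w d p \<open>norm (x - y) \<le> t\<close> sp
          by (intro frac_le mult_mono powr_mono2) (auto simp: neg_part_def pos_part_def)
        finally show ?thesis using True by (simp add: ennreal_leI)
      qed auto
    qed
    finally show ?thesis .
  qed
  have "ennreal (d powr p * (?\<omega> / 2 * t powr (- (s * p)))) * emeasure lebesgue A
      = (\<integral>\<^sup>+x. ennreal (d powr p * (?\<omega> / 2 * t powr (- (s * p)))) * indicator A x \<partial>lebesgue)"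
    by (intro nn_integral_cmult_indicator[symmetric]) auto
  also have "\<dots> \<le> mixed_energy s p u h x0 r"
    unfolding mixed_energy_def using inner
    by (intro nn_integral_mono) (auto simp: A_def split: split_indicator)
  finally show ?thesis by (simp add: d_def h_def A_def)
qed

text \<open>
  Radii and levels decrease to one half of their initial values with gaps proportional to
  \<open>\<epsilon> n = 2\<^sup>-\<^sup>n\<close>. Instead of an abstract recursion for the measures, the proof maintains the invariant
  that the \<open>n\<close>-th sublevel set has at most half the measure of a ball of radius
  \<open>t n = \<tau> \<theta>\<^sup>n \<rho>\<close>, which is precisely the hypothesis of the preceding lemma. One step multiplies the
  bound by \<open>\<mu> (2\<^sup>n)\<^sup>N\<^sup>+\<^sup>2\<^sup>p (t n / \<rho>)\<^sup>s\<^sup>p\<close>, up to the volume of the unit ball: \<open>\<theta>\<close> is chosen so that the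
  dependence on \<open>n\<close> cancels, and \<open>\<tau>\<close> so that the rest is at most \<open>\<theta>\<^sup>N\<close>.
\<close>

lemma De_Giorgi_lower_bound:
  fixes C s p :: real
  assumes C: "0 < C" and p: "1 < p" and s: "0 < s" "s < 1"
  shows "\<exists>\<tau>>0. \<forall>(u :: real ^ 'n \<Rightarrow> real) x0 \<rho> k.
    u \<in> borel_measurable lebesgue \<and> 0 < \<rho> \<and> 0 < k \<and> mixed_energy_bound C s p u x0 \<rho> k \<and>
    emeasure lebesgue {x \<in> ball x0 \<rho>. u x < k}
      \<le> ennreal (unit_ball_vol (real CARD('n)) * (\<tau> * \<rho>) ^ CARD('n) / 2) \<longrightarrow>
    (AE x in lebesgue. x \<in> ball x0 (\<rho> / 2) \<longrightarrow> k / 2 \<le> u x)"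
proof -
  let ?N = "real CARD('n)" and ?\<omega> = "unit_ball_vol (real CARD('n))"
  define b where "b = ?N + 2 * p"
  define \<theta> where "\<theta> = 2 powr (- (b / (s * p)))"
  define \<mu> where "\<mu> = C * 4 powr (?N + p) * 8 powr p * 2 powr (s * p)"
  define \<tau> where "\<tau> = min (1 / 4) ((?\<omega> / 2 * \<theta> ^ CARD('n) / \<mu>) powr (1 / (s * p)))"
  have sp: "0 < s * p" using p s by simp
  have \<mu>: "0 < \<mu>" using C by (simp add: \<mu>_def)
  have \<omega>: "?\<omega> \<noteq> 0"
    using unit_ball_vol_pos[OF of_nat_0_le_iff] by (metis less_irrefl)
  have \<theta>: "0 < \<theta>" "\<theta> \<le> 1 / 2"
  proof -
    have "s * p \<le> p" using p s by simp
    then have "s * p \<le> b" using p unfolding b_def by linarith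
    then have "1 \<le> b / (s * p)" using sp by simp
    then have "\<theta> \<le> 2 powr (- 1)" unfolding \<theta>_def by (intro powr_mono) auto
    then show "\<theta> \<le> 1 / 2" by (simp add: powr_minus)
  qed (simp add: \<theta>_def)
  have \<theta>_sp: "\<theta> powr (s * p) = 1 / 2 powr b"
  proof -
    have "\<theta> powr (s * p) = 2 powr (- b)" using p s by (simp add: \<theta>_def powr_powr)
    then show ?thesis by (simp add: powr_minus_divide)
  qed
  have \<tau>: "0 < \<tau>" "\<tau> \<le> 1 / 4" using \<mu> \<theta> \<omega> by (auto simp: \<tau>_def)
  have \<tau>_sp: "\<mu> * \<tau> powr (s * p) \<le> ?\<omega> / 2 * \<theta> ^ CARD('n)"
  proof -
    have "\<tau> powr (s * p) \<le> ((?\<omega> / 2 * \<theta> ^ CARD('n) / \<mu>) powr (1 / (s * p))) powr (s * p)"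
      using \<tau> sp by (intro powr_mono2) (auto simp: \<tau>_def)
    also have "\<dots> = ?\<omega> / 2 * \<theta> ^ CARD('n) / \<mu>"
      using p s \<mu> \<theta> by (simp add: powr_powr)
    finally show ?thesis using \<mu> by (simp add: field_simps)
  qed
  have "AE x in lebesgue. x \<in> ball x0 (\<rho> / 2) \<longrightarrow> k / 2 \<le> u x"
    if um: "u \<in> borel_measurable lebesgue" and \<rho>: "0 < \<rho>" and k: "0 < k"
      and bound: "mixed_energy_bound C s p u x0 \<rho> k"
      and start: "emeasure lebesgue {x \<in> ball x0 \<rho>. u x < k} \<le> ennreal (?\<omega> * (\<tau> * \<rho>) ^ CARD('n) / 2)"
    for u :: "real ^ 'n \<Rightarrow> real" and x0 \<rho> k
  proof -
    define \<epsilon> where "\<epsilon> n = (1 / 2 :: real) ^ n" for n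
    define r where "r n = \<rho> / 2 * (1 + \<epsilon> n)" for n
    define l where "l n = k / 2 * (1 + \<epsilon> n)" for n
    define t where "t n = \<tau> * \<theta> ^ n * \<rho>" for n
    define A where "A n = {x \<in> ball x0 (r n). u x < l n}" for n
    have \<epsilon>: "0 < \<epsilon> n" "\<epsilon> n \<le> 1" "\<epsilon> (Suc n) = \<epsilon> n / 2" for n
      by (auto simp: \<epsilon>_def power_le_one)
    have t: "0 < t n" for n using \<tau> \<theta> \<rho> by (simp add: t_def)
    have decay: "emeasure lebesgue (A n) \<le> ennreal (?\<omega> * t n ^ CARD('n) / 2)" for n
    proof (induction n)
      case 0
      show ?case using start by (simp add: A_def r_def l_def t_def \<epsilon>_def)
    next
      case (Suc n)
      have gap: "r n - r (Suc n) = \<rho> * \<epsilon> n / 4" "(l n - l (Suc n)) / 2 = k * \<epsilon> n / 8"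
        by (auto simp: r_def l_def \<epsilon> field_simps)
      have r: "0 < r (Suc n)" "r (Suc n) < r n" "r n \<le> \<rho>" "\<rho> / 2 \<le> r n"
        using \<rho> mult_pos_pos[OF \<rho> \<epsilon>(1)[of n]] mult_left_le[OF \<epsilon>(2)[of n] less_imp_le[OF \<rho>]]
        unfolding r_def \<epsilon>(3) distrib_left by linarith+
      have l: "0 < (l (Suc n) + l n) / 2" "(l (Suc n) + l n) / 2 \<le> l n" "l (Suc n) < l n" "l n \<le> k"
      proof -
        have "l n = k / 2 + k * \<epsilon> n / 2" "l (Suc n) = k / 2 + k * \<epsilon> n / 4"
          by (auto simp: l_def \<epsilon>(3) algebra_simps add_divide_distrib)
        note facts = this k mult_pos_pos[OF k \<epsilon>(1)[of n]] mult_left_le[OF \<epsilon>(2)[of n] less_imp_le[OF k]]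
        show "0 < (l (Suc n) + l n) / 2" using facts unfolding add_divide_distrib by linarith
        show "(l (Suc n) + l n) / 2 \<le> l n" using facts unfolding add_divide_distrib by linarith
        show "l (Suc n) < l n" using facts by linarith
        show "l n \<le> k" using facts by linarith
      qed
      \<comment> \<open>The radius \<open>t n\<close> fits into the gap between consecutive balls; this is why
        \<open>\<theta> \<le> 1/2\<close> and \<open>\<tau> \<le> 1/4\<close> are required.\<close>
      have "\<tau> * \<theta> ^ n \<le> 1 / 4 * \<epsilon> n"
        unfolding \<epsilon>_def using \<tau> \<theta> by (intro mult_mono power_mono) auto
      then have t_le: "t n \<le> r n - r (Suc n)"
        using \<rho> by (simp add: gap t_def field_simps)
      define h where "h = (l (Suc n) + l n) / 2"
      define P where "P = (k * \<epsilon> n / 8) powr p"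
      define X where "X = P * (?\<omega> / 2 * t n powr (- (s * p)))"
      define Y where "Y = C * (4 / \<epsilon> n) powr (?N + p) * (\<rho> / 2) powr (- (s * p)) * k powr p"
      have "0 \<le> Y" using C by (simp add: Y_def)
      have "0 < P" using k \<epsilon>[of n] by (simp add: P_def)
      then have "0 < X" using t[of n] by (simp add: X_def)
      have "ennreal X * emeasure lebesgue (A (Suc n)) \<le> mixed_energy s p u h x0 (r (Suc n))"
        using sublevel_mass_le_mixed_energy[OF p less_imp_le[OF sp] um l(3) t t_le, of x0] Suc.IH
        by (simp add: X_def P_def A_def h_def gap)
      also have "\<dots> \<le> ennreal (C * (r n / (r n - r (Suc n))) powr (?N + p) * r n powr (- (s * p)) * k powr p)
          * emeasure lebesgue {x \<in> ball x0 (r n). u x < h}"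
        using r l by (intro mixed_energy_boundD[OF bound]) (auto simp: h_def)
      also have "\<dots> \<le> ennreal Y * ennreal (?\<omega> * t n ^ CARD('n) / 2)"
      proof (intro mult_mono ennreal_leI)
        have "r n / (r n - r (Suc n)) \<le> 4 / \<epsilon> n"
          using \<rho> \<epsilon>[of n] by (simp add: gap r_def field_simps)
        then have "(r n / (r n - r (Suc n))) powr (?N + p) \<le> (4 / \<epsilon> n) powr (?N + p)"
          using r p by (intro powr_mono2) auto
        moreover have "r n powr (- (s * p)) \<le> (\<rho> / 2) powr (- (s * p))"
          using r \<rho> sp by (intro powr_mono2') auto
        ultimately show "C * (r n / (r n - r (Suc n))) powr (?N + p) * r n powr (- (s * p)) * k powr p \<le> Y"
          unfolding Y_def using C by (intro mult_mono) auto
        have "emeasure lebesgue {x \<in> ball x0 (r n). u x < h} \<le> emeasure lebesgue (A n)"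
          unfolding A_def using l um
          by (intro emeasure_mono sublevel_in_ball_measurable) (auto simp: h_def)
        then show "emeasure lebesgue {x \<in> ball x0 (r n). u x < h} \<le> ennreal (?\<omega> * t n ^ CARD('n) / 2)"
          using Suc.IH by (rule order_trans)
      qed auto
      finally have ineq: "ennreal X * emeasure lebesgue (A (Suc n)) \<le> ennreal (Y * (?\<omega> * t n ^ CARD('n) / 2))"
        using ennreal_mult'[OF \<open>0 \<le> Y\<close>] by metis
      \<comment> \<open>Here the powers of \<open>\<epsilon> n\<close> cancel, by the choice of \<open>\<theta>\<close>.\<close>
      have "Y * (?\<omega> * t n ^ CARD('n) / 2) = X * (\<mu> * \<tau> powr (s * p) * t n ^ CARD('n))"
      proof -
        have k_p: "k powr p = P * (8 powr p / \<epsilon> n powr p)"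
          using k \<epsilon>[of n] by (simp add: P_def powr_mult powr_divide)
        have four: "(4 / \<epsilon> n) powr (?N + p) = 4 powr (?N + p) / \<epsilon> n powr (?N + p)"
          using \<epsilon>[of n] by (simp add: powr_divide)
        have b_split: "\<epsilon> n powr b = \<epsilon> n powr (?N + p) * \<epsilon> n powr p"
          by (simp add: b_def add_ac flip: powr_add)
        have \<rho>_sp: "1 / (\<rho> / 2) powr (s * p) = 2 powr (s * p) / \<rho> powr (s * p)"
          using \<rho> by (simp add: powr_divide)
        have t_sp: "t n powr (s * p) = \<tau> powr (s * p) * \<epsilon> n powr b * \<rho> powr (s * p)"
        proof -
          have power_powr: "(x ^ n) powr c = (x powr c) ^ n" if "0 < x" for x c :: real
            using that by (simp add: powr_powr powr_realpow[symmetric] mult.commute)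
          have "(\<theta> ^ n) powr (s * p) = (1 / 2 powr b) ^ n"
            by (simp only: power_powr \<theta> \<theta>_sp)
          also have "\<dots> = \<epsilon> n powr b"
            by (simp add: \<epsilon>_def power_powr powr_divide)
          finally show ?thesis using \<tau> \<theta> \<rho> by (simp add: t_def powr_mult)
        qed
        have cancel: "C * (a4 / EN) * (a2 / R) * (P * (a8 / EP)) * (w * T / 2)
            = P * (w / 2 * (1 / (\<tau>' * (EN * EP) * R))) * (C * a4 * a8 * a2 * \<tau>' * T)"
          if "0 < EN" "0 < EP" "0 < R" "0 < \<tau>'" for a4 a2 a8 EN EP R w T \<tau>' :: real
          using that by (simp add: field_simps)
        show ?thesis
          unfolding Y_def X_def four k_p \<mu>_def powr_minus_divide \<rho>_sp t_sp b_split
          using \<epsilon>(1)[of n] \<rho> \<tau>(1) by (intro cancel) auto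
      qed
      also have "\<dots> \<le> X * (?\<omega> / 2 * \<theta> ^ CARD('n) * t n ^ CARD('n))"
        using \<open>0 < X\<close> \<tau>_sp t[of n] by (intro mult_left_mono mult_right_mono) auto
      also have "\<dots> = X * (?\<omega> * t (Suc n) ^ CARD('n) / 2)"
        by (simp add: t_def power_mult_distrib field_simps)
      finally have "ennreal X * emeasure lebesgue (A (Suc n)) \<le> ennreal (X * (?\<omega> * t (Suc n) ^ CARD('n) / 2))"
        using ineq by (meson ennreal_leI order_trans)
      also have "\<dots> = ennreal X * ennreal (?\<omega> * t (Suc n) ^ CARD('n) / 2)"
        using \<open>0 < X\<close> by (intro ennreal_mult') auto
      finally show ?case
        using \<open>0 < X\<close> by (subst (asm) ennreal_mult_le_mult_iff) auto
    qed
    define Z where "Z = {x \<in> ball x0 (\<rho> / 2). u x < k / 2}"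
    have Zm: "Z \<in> sets lebesgue" unfolding Z_def by (intro sublevel_in_ball_measurable um)
    have "emeasure lebesgue Z \<le> ennreal (?\<omega> * t n ^ CARD('n) / 2)" for n
    proof -
      have "\<rho> / 2 \<le> r n" "k / 2 \<le> l n"
        using \<rho> k \<epsilon>[of n] by (auto simp: r_def l_def)
      then have "Z \<subseteq> A n" by (auto simp: Z_def A_def)
      then have "emeasure lebesgue Z \<le> emeasure lebesgue (A n)"
        unfolding A_def by (intro emeasure_mono sublevel_in_ball_measurable um)
      then show ?thesis using decay by (rule order_trans)
    qed
    moreover have "(\<lambda>n. ennreal (?\<omega> * t n ^ CARD('n) / 2)) \<longlonglongrightarrow> ennreal 0"
    proof (rule tendsto_ennrealI)
      have "t \<longlonglongrightarrow> \<tau> * 0 * \<rho>"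
        unfolding t_def using \<theta> by (intro tendsto_intros LIMSEQ_realpow_zero) auto
      then have "(\<lambda>n. ?\<omega> * t n ^ CARD('n) / 2) \<longlonglongrightarrow> ?\<omega> * (\<tau> * 0 * \<rho>) ^ CARD('n) / 2"
        by (intro tendsto_intros) auto
      also have "?\<omega> * (\<tau> * 0 * \<rho>) ^ CARD('n) / 2 = 0"
        by (simp add: power_0_left)
      finally show "(\<lambda>n. ?\<omega> * t n ^ CARD('n) / 2) \<longlonglongrightarrow> 0" .
    qed
    ultimately have "emeasure lebesgue Z \<le> ennreal 0"
      by (intro LIMSEQ_le_const) auto
    then have "AE x in lebesgue. x \<notin> Z"
      using Zm by (intro AE_not_in) (auto intro: null_setsI)
    then show ?thesis by eventually_elim (auto simp: Z_def)
  qed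
  with \<tau>(1) show ?thesis by blast
qed

section \<open>From a large mean to a small sublevel set\<close>

text \<open>
  Two points of \<open>K\<^sub>\<rho>\<close> have distance at most \<open>2\<rho>\<close>, so the mixed energy on \<open>K\<^sub>\<rho>\<close> is at least
  \<open>(2\<rho>)\<^sup>-\<^sup>N\<^sup>-\<^sup>s\<^sup>p (k/2) |{u < k/2}|\<close> times the integral \<open>J\<close> of \<open>w\<^sub>+\<^sup>p\<^sup>-\<^sup>1\<close> over \<open>K\<^sub>\<rho>\<close>, while
  its upper bound is of order \<open>k\<^sup>p \<rho>\<^sup>N\<^sup>-\<^sup>s\<^sup>p\<close>. A large mean of \<open>u\<^sup>p\<^sup>-\<^sup>1\<close> makes \<open>J\<close> at least
  \<open>L k\<^sup>p\<^sup>-\<^sup>1 |K\<^sub>\<rho>|\<close>, so the sublevel set occupies a fraction of order \<open>1/L\<close>.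
\<close>

lemma large_mean_imp_small_sublevel:
  fixes C s p \<tau> :: real
  assumes C: "0 < C" and p: "1 < p" and s: "0 < s" and \<tau>: "0 < \<tau>"
  shows "\<exists>M>0. \<forall>(u :: real ^ 'n \<Rightarrow> real) x0 \<rho> k.
    u \<in> borel_measurable lebesgue \<and> (AE x in lebesgue. x \<in> ball x0 \<rho> \<longrightarrow> 0 \<le> u x) \<and>
    0 < \<rho> \<and> 0 < k \<and> mixed_energy_bound C s p u x0 (2 * \<rho>) k \<and>
    ennreal (M * k powr (p - 1)) * emeasure lebesgue (ball x0 \<rho>)
      \<le> (\<integral>\<^sup>+x\<in>ball x0 \<rho>. ennreal (u x powr (p - 1)) \<partial>lebesgue) \<longrightarrow>
    emeasure lebesgue {x \<in> ball x0 \<rho>. u x < k / 2}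
      \<le> ennreal (unit_ball_vol (real CARD('n)) * (\<tau> * \<rho>) ^ CARD('n) / 2)"
proof -
  let ?N = "real CARD('n)" and ?\<omega> = "unit_ball_vol (real CARD('n))" and ?c = "2 powr (p - 1)"
  define L where "L = 4 * C * 2 powr (?N + p) * 4 ^ CARD('n) / (?\<omega> * \<tau> ^ CARD('n))"
  define M where "M = ?c * (L + 1)"
  have \<omega>: "?\<omega> \<noteq> 0"
    using unit_ball_vol_pos[OF of_nat_0_le_iff] by (metis less_irrefl)
  have L: "0 < L" using C \<tau> by (auto simp: L_def intro!: divide_pos_pos mult_pos_pos)
  have "0 < M" using L by (auto simp: M_def intro!: mult_pos_pos)
  moreover have "emeasure lebesgue {x \<in> ball x0 \<rho>. u x < k / 2} \<le> ennreal (?\<omega> * (\<tau> * \<rho>) ^ CARD('n) / 2)"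
    if um [measurable]: "u \<in> borel_measurable lebesgue"
      and nonneg: "AE x in lebesgue. x \<in> ball x0 \<rho> \<longrightarrow> 0 \<le> u x"
      and \<rho>: "0 < \<rho>" and k: "0 < k" and bound: "mixed_energy_bound C s p u x0 (2 * \<rho>) k"
      and mean: "ennreal (M * k powr (p - 1)) * emeasure lebesgue (ball x0 \<rho>)
        \<le> (\<integral>\<^sup>+x\<in>ball x0 \<rho>. ennreal (u x powr (p - 1)) \<partial>lebesgue)"
    for u :: "real ^ 'n \<Rightarrow> real" and x0 \<rho> k
  proof -
    define V where "V = ?\<omega> * \<rho> ^ CARD('n)"
    have V: "0 < V" "emeasure lebesgue (ball x0 \<rho>) = ennreal V"
      using \<rho> by (auto simp: V_def emeasure_lebesgue_ball)
    define A where "A = {x \<in> ball x0 \<rho>. u x < k / 2}"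
    have [measurable]: "A \<in> sets lebesgue"
      unfolding A_def by (intro sublevel_in_ball_measurable um)
    have [measurable]: "(\<lambda>x. pos_part (u x - k)) \<in> borel_measurable lebesgue"
      by (simp add: pos_part_def)
    have [measurable]: "ball x0 \<rho> \<in> sets lebesgue" by simp
    define J where "J = (\<integral>\<^sup>+y\<in>ball x0 \<rho>. ennreal (pos_part (u y - k) powr (p - 1)) \<partial>lebesgue)"
    have J: "ennreal (L * k powr (p - 1) * V) \<le> J"
    proof -
      have "AE x in lebesgue. ennreal (u x powr (p - 1)) * indicator (ball x0 \<rho>) x
          \<le> ennreal ?c * (ennreal (pos_part (u x - k) powr (p - 1)) * indicator (ball x0 \<rho>) x)
            + ennreal (?c * k powr (p - 1)) * indicator (ball x0 \<rho>) x"
        using nonneg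
      proof eventually_elim
        case (elim x)
        show ?case
        proof (cases "x \<in> ball x0 \<rho>")
          case True
          have "u x powr (p - 1) \<le> (pos_part (u x - k) + k) powr (p - 1)"
            using elim True p by (intro powr_mono2) (auto simp: pos_part_def)
          also have "\<dots> \<le> ?c * (pos_part (u x - k) powr (p - 1) + k powr (p - 1))"
            using p k by (intro powr_add_le) (auto simp: pos_part_def)
          finally have "ennreal (u x powr (p - 1))
              \<le> ennreal (?c * pos_part (u x - k) powr (p - 1) + ?c * k powr (p - 1))"
            by (intro ennreal_leI) (simp add: algebra_simps)
          also have "\<dots> = ennreal ?c * ennreal (pos_part (u x - k) powr (p - 1)) + ennreal (?c * k powr (p - 1))"
            by (subst ennreal_plus) (simp_all flip: ennreal_mult)
          finally show ?thesis using True by simp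
        qed auto
      qed
      then have "(\<integral>\<^sup>+x\<in>ball x0 \<rho>. ennreal (u x powr (p - 1)) \<partial>lebesgue)
          \<le> (\<integral>\<^sup>+x. ennreal ?c * (ennreal (pos_part (u x - k) powr (p - 1)) * indicator (ball x0 \<rho>) x)
            + ennreal (?c * k powr (p - 1)) * indicator (ball x0 \<rho>) x \<partial>lebesgue)"
        by (rule nn_integral_mono_AE)
      also have "\<dots> = ennreal ?c * J + ennreal (?c * k powr (p - 1)) * ennreal V"
        unfolding J_def V(2)[symmetric]
        by (subst nn_integral_add, measurable, subst nn_integral_cmult, measurable,
            subst nn_integral_cmult_indicator, measurable)
      finally have le: "ennreal (M * k powr (p - 1)) * ennreal V
          \<le> ennreal ?c * J + ennreal (?c * k powr (p - 1)) * ennreal V"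
        by (rule order_trans[OF mean[unfolded V(2)]])
      show ?thesis
      proof (cases J)
        case (real j)
        have "ennreal (M * k powr (p - 1) * V) \<le> ennreal (?c * j + ?c * k powr (p - 1) * V)"
        proof -
          have "ennreal (M * k powr (p - 1) * V) = ennreal (M * k powr (p - 1)) * ennreal V"
            using V(1) by (intro ennreal_mult'') auto
          also note le
          also have "ennreal ?c * J + ennreal (?c * k powr (p - 1)) * ennreal V
              = ennreal (?c * j + ?c * k powr (p - 1) * V)"
            using real V(1) by (subst ennreal_plus) (simp_all flip: ennreal_mult)
          finally show ?thesis .
        qed
        then have "M * k powr (p - 1) * V \<le> ?c * j + ?c * k powr (p - 1) * V"
          using real V(1) by (subst (asm) ennreal_le_iff) auto
        then have "?c * (L * k powr (p - 1) * V) \<le> ?c * j"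
          by (simp add: M_def algebra_simps)
        then show ?thesis using real by (simp add: ennreal_leI)
      qed simp
    qed
    define c where "c = k / 2 / (2 * \<rho>) powr (?N + s * p)"
    have c: "0 < c" using k \<rho> by (simp add: c_def)
    have inner: "ennreal c * J \<le> (\<integral>\<^sup>+y. ennreal (neg_part (u x - k) * pos_part (u y - k) powr (p - 1)
        / norm (x - y) powr (?N + s * p)) \<partial>lebesgue)" if x: "x \<in> A" for x
    proof -
      have "ennreal c * J = (\<integral>\<^sup>+y. ennreal c * (ennreal (pos_part (u y - k) powr (p - 1))
          * indicator (ball x0 \<rho>) y) \<partial>lebesgue)"
        unfolding J_def by (subst nn_integral_cmult) measurable
      also have "\<dots> \<le> (\<integral>\<^sup>+y. ennreal (neg_part (u x - k) * pos_part (u y - k) powr (p - 1)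
        / norm (x - y) powr (?N + s * p)) \<partial>lebesgue)"
      proof (intro nn_integral_mono)
        fix y
        show "ennreal c * (ennreal (pos_part (u y - k) powr (p - 1)) * indicator (ball x0 \<rho>) y)
            \<le> ennreal (neg_part (u x - k) * pos_part (u y - k) powr (p - 1) / norm (x - y) powr (?N + s * p))"
        proof (cases "y \<in> ball x0 \<rho> \<and> y \<noteq> x")
          case True
          have "norm (x - y) \<le> 2 * \<rho>"
            using True x dist_triangle[of x y x0] by (auto simp: A_def dist_norm norm_minus_commute)
          moreover have "k / 2 \<le> neg_part (u x - k)"
            using x unfolding A_def neg_part_def by (simp add: le_max_iff_disj)
          moreover have "0 \<le> neg_part (u x - k)"
            by (simp add: neg_part_def)
          ultimately have "k / 2 * pos_part (u y - k) powr (p - 1) / (2 * \<rho>) powr (?N + s * p)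
              \<le> neg_part (u x - k) * pos_part (u y - k) powr (p - 1) / norm (x - y) powr (?N + s * p)"
            using True k p s by (intro frac_le mult_right_mono powr_mono2) auto
          then have "ennreal (c * pos_part (u y - k) powr (p - 1))
              \<le> ennreal (neg_part (u x - k) * pos_part (u y - k) powr (p - 1) / norm (x - y) powr (?N + s * p))"
            by (intro ennreal_leI) (simp add: c_def)
          then show ?thesis using True c by (simp add: ennreal_mult)
        next
          case False
          have "pos_part (u x - k) = 0" using x k by (auto simp: A_def pos_part_def)
          then show ?thesis using False by (cases "y = x") auto
        qed
      qed
      finally show ?thesis .
    qed
    \<comment> \<open>The constant \<open>L\<close> is the solution of this equation.\<close>
    have const: "C * 2 powr (?N + p) * (2 * \<rho>) powr (- (s * p)) * k powr p * (2 ^ CARD('n) * V)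
        = c * (L * k powr (p - 1) * V) * (?\<omega> * (\<tau> * \<rho>) ^ CARD('n) / 2)"
    proof -
      have "(2 * \<rho>) powr (?N + s * p) = 2 ^ CARD('n) * \<rho> ^ CARD('n) * (2 * \<rho>) powr (s * p)"
        using \<rho> by (simp add: powr_add powr_realpow power_mult_distrib)
      then have c_eq: "c = k / 2 * (2 * \<rho>) powr (- (s * p)) / (2 ^ CARD('n) * \<rho> ^ CARD('n))"
        by (simp add: c_def powr_minus_divide)
      have k_p: "k powr p = k * k powr (p - 1)"
        using k by (simp add: powr_diff)
      have four: "(4 :: real) ^ CARD('n) = 2 ^ CARD('n) * 2 ^ CARD('n)"
        by (simp flip: power_mult_distrib)
      have cancel: "C * P * q * (k * K) * (D * V) = k / 2 * q / (D * R) * (4 * C * P * (D * D) / (w * T) * K * V) * (w * (T * R) / 2)"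
        if "0 < D" "0 < R" "w \<noteq> 0" "0 < T" for P q K D R T w :: real
        using that by (simp add: field_simps)
      show ?thesis
        unfolding c_eq L_def k_p four power_mult_distrib[of \<tau>]
        using \<omega> \<tau> \<rho> by (intro cancel) auto
    qed
    have "ennreal (c * (L * k powr (p - 1) * V)) * emeasure lebesgue A
        = ennreal c * ennreal (L * k powr (p - 1) * V) * emeasure lebesgue A"
      using c L V by (simp add: ennreal_mult)
    also have "\<dots> \<le> ennreal c * J * emeasure lebesgue A"
      using J by (intro mult_right_mono mult_left_mono) auto
    also have "\<dots> = (\<integral>\<^sup>+x. ennreal c * J * indicator A x \<partial>lebesgue)"
      by (intro nn_integral_cmult_indicator[symmetric]) auto
    also have "\<dots> \<le> mixed_energy s p u k x0 \<rho>"
      unfolding mixed_energy_def using inner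
      by (intro nn_integral_mono) (auto simp: A_def split: split_indicator)
    also have "\<dots> \<le> ennreal (C * (2 * \<rho> / (2 * \<rho> - \<rho>)) powr (?N + p) * (2 * \<rho>) powr (- (s * p)) * k powr p)
        * emeasure lebesgue {x \<in> ball x0 (2 * \<rho>). u x < k}"
      using k \<rho> by (intro mixed_energy_boundD[OF bound]) auto
    also have "\<dots> \<le> ennreal (C * 2 powr (?N + p) * (2 * \<rho>) powr (- (s * p)) * k powr p)
        * ennreal (2 ^ CARD('n) * V)"
    proof (intro mult_mono ennreal_leI)
      have "emeasure lebesgue {x \<in> ball x0 (2 * \<rho>). u x < k} \<le> emeasure lebesgue (ball x0 (2 * \<rho>))"
        by (intro emeasure_mono) auto
      also have "\<dots> = ennreal (2 ^ CARD('n) * V)"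
        using \<rho> by (simp add: emeasure_lebesgue_ball V_def power_mult_distrib mult_ac)
      finally show "emeasure lebesgue {x \<in> ball x0 (2 * \<rho>). u x < k} \<le> ennreal (2 ^ CARD('n) * V)" .
    qed (use C \<rho> in auto)
    also have "\<dots> = ennreal (C * 2 powr (?N + p) * (2 * \<rho>) powr (- (s * p)) * k powr p * (2 ^ CARD('n) * V))"
      using C V by (intro ennreal_mult[symmetric]) auto
    also have "\<dots> = ennreal (c * (L * k powr (p - 1) * V)) * ennreal (?\<omega> * (\<tau> * \<rho>) ^ CARD('n) / 2)"
      unfolding const using c L V by (intro ennreal_mult') auto
    finally show ?thesis
      unfolding A_def[symmetric] using c L V k
      by (subst (asm) ennreal_mult_le_mult_iff) (auto simp: ennreal_eq_0_iff not_le intro!: mult_pos_pos)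
  qed
  ultimately show ?thesis by blast
qed

section \<open>The weak Harnack estimate\<close>

text \<open>
  The integrability condition of the class makes the mean of \<open>u\<^sup>p\<^sup>-\<^sup>1\<close> over a ball finite, so
  that the truncation level in the theorem is a real number.
\<close>

lemma ball_integral_finite_of_weighted:
  fixes u :: "real ^ 'n \<Rightarrow> real"
  assumes um: "u \<in> borel_measurable lebesgue" and a: "0 \<le> a" and \<rho>: "0 < \<rho>"
    and fin: "(\<integral>\<^sup>+x. ennreal (\<bar>u x\<bar> powr q / (1 + norm x powr a)) \<partial>lebesgue) < \<infinity>"
    and nonneg: "AE x in lebesgue. x \<in> ball x0 \<rho> \<longrightarrow> 0 \<le> u x"
  shows "(\<integral>\<^sup>+x\<in>ball x0 \<rho>. ennreal (u x powr q) \<partial>lebesgue) < \<infinity>"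
proof -
  note [measurable] = um
  define D where "D = 1 + (norm x0 + \<rho>) powr a"
  have "AE x in lebesgue. ennreal (u x powr q) * indicator (ball x0 \<rho>) x
      \<le> ennreal D * ennreal (\<bar>u x\<bar> powr q / (1 + norm x powr a))"
    using nonneg
  proof eventually_elim
    case (elim x)
    show ?case
    proof (cases "x \<in> ball x0 \<rho>")
      case True
      have "norm x \<le> norm x0 + \<rho>"
        using True norm_triangle_ineq2[of x x0] by (simp add: dist_norm norm_minus_commute)
      then have "1 + norm x powr a \<le> D"
        using a by (auto simp: D_def intro!: powr_mono2)
      moreover have "0 < 1 + norm x powr a" by (simp add: add_pos_nonneg)
      ultimately have "u x powr q \<le> D * (\<bar>u x\<bar> powr q / (1 + norm x powr a))"
        using elim True mult_right_mono[of "1 + norm x powr a" D "u x powr q"]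
        by (simp add: field_simps)
      moreover have "0 \<le> D" by (simp add: D_def)
      ultimately show ?thesis using True by (simp add: ennreal_leI flip: ennreal_mult')
    qed auto
  qed
  then have "(\<integral>\<^sup>+x\<in>ball x0 \<rho>. ennreal (u x powr q) \<partial>lebesgue)
      \<le> (\<integral>\<^sup>+x. ennreal D * ennreal (\<bar>u x\<bar> powr q / (1 + norm x powr a)) \<partial>lebesgue)"
    by (rule nn_integral_mono_AE)
  also have "\<dots> = ennreal D * (\<integral>\<^sup>+x. ennreal (\<bar>u x\<bar> powr q / (1 + norm x powr a)) \<partial>lebesgue)"
    by (intro nn_integral_cmult) measurable
  also have "\<dots> < \<infinity>"
    using fin by (simp add: ennreal_mult_less_top)
  finally show ?thesis .
qed

lemma essinf_on_ge:
  fixes u :: "real ^ 'n \<Rightarrow> real"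
  assumes um: "u \<in> borel_measurable lebesgue" and A: "A \<in> sets lebesgue"
    and ge: "AE x in lebesgue. x \<in> A \<longrightarrow> c \<le> u x"
  shows "ereal c \<le> essinf_on A u"
proof -
  have "u \<in> borel_measurable (lebesgue_on A)"
    using um by (rule measurable_restrict_space1)
  moreover have "AE x in lebesgue_on A. - ereal (u x) \<le> - ereal c"
    using ge A by (subst AE_restrict_space_iff) auto
  ultimately have "esssup (lebesgue_on A) (\<lambda>x. - ereal (u x)) \<le> - ereal c"
    by (intro esssup_I) auto
  then show ?thesis
    unfolding essinf_on_def by (metis ereal_minus_le_minus ereal_uminus_uminus)
qed

lemma mixed_energy_bound_subset:
  "mixed_energy_bound C s p u x0 S k \<Longrightarrow> S' \<le> S \<Longrightarrow> mixed_energy_bound C s p u x0 S' k"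
  unfolding mixed_energy_bound_def by (meson order_trans)

theorem theorem7p1:
  fixes s p \<gamma> :: real
  assumes "p > 1" and "0 < s" and "s < 1" and "\<gamma> > 0"
  shows "\<exists>\<eta>::real. 0 < \<eta> \<and> \<eta> < 1 \<and>
    (\<forall>(E :: (real ^ 'n) set) u x\<^sub>o R \<rho>.
       bounded E \<and> open E \<and> u \<in> DG_minus s p \<gamma> E \<and>
       0 < R \<and> ball x\<^sub>o R \<subseteq> E \<and>
       (AE x in lebesgue. x \<in> ball x\<^sub>o R \<longrightarrow> 0 \<le> u x) \<and>
       0 < \<rho> \<and> ball x\<^sub>o (2 * \<rho>) \<subseteq> ball x\<^sub>o R
       \<longrightarrow>
       essinf_on (ball x\<^sub>o (\<rho> / 2)) u
         + ereal ((\<rho> / R) powr (s * p / (p - 1)))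
           * enn2ereal (Tail s p (\<lambda>x. neg_part (u x)) x\<^sub>o R)
       \<ge> ereal \<eta>
           * enn2ereal
               (ennpowr
                 ((\<integral>\<^sup>+x\<in>ball x\<^sub>o \<rho>. ennreal (u x powr (p - 1)) \<partial>lebesgue)
                    / emeasure lebesgue (ball x\<^sub>o \<rho>))
                 (1 / (p - 1))))"
proof -
  let ?N = "real CARD('n)" and ?\<omega> = "unit_ball_vol (real CARD('n))"
  note p = assms(1) and s = assms(2,3) and \<gamma> = assms(4)
  obtain C where C: "0 < C" and energy: "\<And>(E :: (real ^ 'n) set) u x0 S R k.
      u \<in> DG_minus s p \<gamma> E \<Longrightarrow> ball x0 R \<subseteq> E \<Longrightarrow> (AE x in lebesgue. x \<in> ball x0 R \<longrightarrow> 0 \<le> u x) \<Longrightarrow>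
      S \<le> R \<Longrightarrow>
      ennreal ((S / R) powr (s * p)) * ennpowr (Tail s p (\<lambda>x. neg_part (u x)) x0 R) (p - 1)
        \<le> ennreal (k powr (p - 1)) \<Longrightarrow>
      mixed_energy_bound C s p u x0 S k"
    using DG_minus_mixed_energy_bound[OF p s \<gamma>, where ?'n = 'n] by blast
  obtain \<tau> where \<tau>: "0 < \<tau>" and De_Giorgi: "\<And>(u :: real ^ 'n \<Rightarrow> real) x0 \<rho> k.
      u \<in> borel_measurable lebesgue \<Longrightarrow> 0 < \<rho> \<Longrightarrow> 0 < k \<Longrightarrow> mixed_energy_bound C s p u x0 \<rho> k \<Longrightarrow>
      emeasure lebesgue {x \<in> ball x0 \<rho>. u x < k} \<le> ennreal (?\<omega> * (\<tau> * \<rho>) ^ CARD('n) / 2) \<Longrightarrow>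
      (AE x in lebesgue. x \<in> ball x0 (\<rho> / 2) \<longrightarrow> k / 2 \<le> u x)"
    using De_Giorgi_lower_bound[OF C p s, where ?'n = 'n] by blast
  obtain M where M: "0 < M" and small_sublevel: "\<And>(u :: real ^ 'n \<Rightarrow> real) x0 \<rho> k.
      u \<in> borel_measurable lebesgue \<Longrightarrow> (AE x in lebesgue. x \<in> ball x0 \<rho> \<longrightarrow> 0 \<le> u x) \<Longrightarrow>
      0 < \<rho> \<Longrightarrow> 0 < k \<Longrightarrow> mixed_energy_bound C s p u x0 (2 * \<rho>) k \<Longrightarrow>
      ennreal (M * k powr (p - 1)) * emeasure lebesgue (ball x0 \<rho>)
        \<le> (\<integral>\<^sup>+x\<in>ball x0 \<rho>. ennreal (u x powr (p - 1)) \<partial>lebesgue) \<Longrightarrow>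
      emeasure lebesgue {x \<in> ball x0 \<rho>. u x < k / 2} \<le> ennreal (?\<omega> * (\<tau> * \<rho>) ^ CARD('n) / 2)"
    using large_mean_imp_small_sublevel[OF C p s(1) \<tau>, where ?'n = 'n] by blast
  define a where "a = s * p / (p - 1)"
  define \<delta> where "\<delta> = min (1 / 4) (2 powr (- a) / 2)"
  define \<eta> where "\<eta> = min (1 / 2) (\<delta> / M powr (1 / (p - 1)))"
  have \<eta>: "0 < \<eta>" "\<eta> < 1" using M by (auto simp: \<eta>_def \<delta>_def)
  have "ereal \<eta> * enn2ereal (ennpowr
          ((\<integral>\<^sup>+x\<in>ball x0 \<rho>. ennreal (u x powr (p - 1)) \<partial>lebesgue) / emeasure lebesgue (ball x0 \<rho>)) (1 / (p - 1)))
      \<le> essinf_on (ball x0 (\<rho> / 2)) u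
        + ereal ((\<rho> / R) powr (s * p / (p - 1))) * enn2ereal (Tail s p (\<lambda>x. neg_part (u x)) x0 R)"
    if u: "u \<in> DG_minus s p \<gamma> E" and R: "0 < R" and E: "ball x0 R \<subseteq> E"
      and nonneg: "AE x in lebesgue. x \<in> ball x0 R \<longrightarrow> 0 \<le> u x"
      and \<rho>: "0 < \<rho>" and sub: "ball x0 (2 * \<rho>) \<subseteq> ball x0 R"
    for E :: "(real ^ 'n) set" and u x0 R \<rho>
  proof -
    let ?T = "Tail s p (\<lambda>x. neg_part (u x)) x0 R"
    have \<rho>R: "2 * \<rho> \<le> R" using sub \<rho> by (simp add: ball_subset_ball_iff)
    have um: "u \<in> borel_measurable lebesgue" using u by (simp add: DG_minus_def)
    have nonneg_ball: "AE x in lebesgue. x \<in> ball x0 t \<longrightarrow> 0 \<le> u x" if "t \<le> R" for t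
      using nonneg by eventually_elim (use that in auto)
    define i where "i = enn2real (\<integral>\<^sup>+x\<in>ball x0 \<rho>. ennreal (u x powr (p - 1)) \<partial>lebesgue)"
    have "(\<integral>\<^sup>+x\<in>ball x0 \<rho>. ennreal (u x powr (p - 1)) \<partial>lebesgue) < \<infinity>"
    proof (rule ball_integral_finite_of_weighted[OF um _ \<rho>])
      show "(\<integral>\<^sup>+x. ennreal (\<bar>u x\<bar> powr (p - 1) / (1 + norm x powr (?N + s * p))) \<partial>lebesgue) < \<infinity>"
        using u by (simp add: DG_minus_def)
    qed (use nonneg_ball \<rho> \<rho>R p s in auto)
    then have i: "(\<integral>\<^sup>+x\<in>ball x0 \<rho>. ennreal (u x powr (p - 1)) \<partial>lebesgue) = ennreal i" "0 \<le> i"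
      by (auto simp: i_def ennreal_enn2real)
    define V where "V = ?\<omega> * \<rho> ^ CARD('n)"
    have V: "0 < V" "emeasure lebesgue (ball x0 \<rho>) = ennreal V"
      using \<rho> by (auto simp: V_def emeasure_lebesgue_ball)
    define m where "m = (i / V) powr (1 / (p - 1))"
    have rhs: "ereal \<eta> * enn2ereal (ennpowr ((\<integral>\<^sup>+x\<in>ball x0 \<rho>. ennreal (u x powr (p - 1)) \<partial>lebesgue)
        / emeasure lebesgue (ball x0 \<rho>)) (1 / (p - 1))) = ereal (\<eta> * m)"
      using i(2) V(1) unfolding i(1) V(2)
      by (simp add: divide_ennreal ennpowr_def m_def enn2ereal_ennreal)
    have essinf_0: "ereal 0 \<le> essinf_on (ball x0 (\<rho> / 2)) u"
      using \<rho> \<rho>R by (intro essinf_on_ge um nonneg_ball) auto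
    have tail_0: "0 \<le> ereal ((\<rho> / R) powr a) * enn2ereal ?T" by simp
    consider "i = 0" | "0 < i" using i(2) by linarith
    then have "ereal (\<eta> * m) \<le> essinf_on (ball x0 (\<rho> / 2)) u + ereal ((\<rho> / R) powr a) * enn2ereal ?T"
    proof cases
      case 1
      then show ?thesis
        using add_mono[OF essinf_0 tail_0] by (simp add: m_def zero_ereal_def)
    next
      case 2
      \<comment> \<open>With this level the mean \<open>i / V\<close> equals \<open>M * k powr (p - 1)\<close>.\<close>
      define k where "k = (i / V / M) powr (1 / (p - 1))"
      have k: "0 < k" using 2 V(1) M by (simp add: k_def)
      have k_pow: "M * k powr (p - 1) * V = i"
        using 2 V(1) M p by (simp add: k_def powr_powr)
      have "m = k * M powr (1 / (p - 1))"
        using 2 V(1) M powr_mult[of "i / V / M" M "1 / (p - 1)"] by (simp add: m_def k_def)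
      moreover have "\<eta> \<le> \<delta> / M powr (1 / (p - 1))" by (simp add: \<eta>_def)
      ultimately have \<eta>m: "\<eta> * m \<le> \<delta> * k"
        using k M by (simp add: field_simps)
      show ?thesis
      proof (cases "ennreal ((2 * \<rho> / R) powr (s * p)) * ennpowr ?T (p - 1) \<le> ennreal ((k / 2) powr (p - 1))")
        case True
        also have "ennreal ((k / 2) powr (p - 1)) \<le> ennreal (k powr (p - 1))"
          using k p by (intro ennreal_leI powr_mono2) auto
        finally have "mixed_energy_bound C s p u x0 (2 * \<rho>) k"
          using u E nonneg \<rho>R by (intro energy)
        moreover have "ennreal (M * k powr (p - 1)) * ennreal V = ennreal i"
          using V(1) M by (simp add: k_pow flip: ennreal_mult)
        ultimately have "emeasure lebesgue {x \<in> ball x0 \<rho>. u x < k / 2} \<le> ennreal (?\<omega> * (\<tau> * \<rho>) ^ CARD('n) / 2)"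
          using \<rho> \<rho>R k i(1) V(2) by (intro small_sublevel um nonneg_ball) simp_all
        moreover have "mixed_energy_bound C s p u x0 \<rho> (k / 2)"
          using \<rho> by (intro mixed_energy_bound_subset[OF energy[OF u E nonneg \<rho>R True]]) auto
        ultimately have "AE x in lebesgue. x \<in> ball x0 (\<rho> / 2) \<longrightarrow> k / 2 / 2 \<le> u x"
          using \<rho> k by (intro De_Giorgi um) simp_all
        then have "ereal (k / 4) \<le> essinf_on (ball x0 (\<rho> / 2)) u"
          using um by (intro essinf_on_ge) auto
        then have lower: "ereal (k / 4) + 0
            \<le> essinf_on (ball x0 (\<rho> / 2)) u + ereal ((\<rho> / R) powr a) * enn2ereal ?T"
          using tail_0 by (rule add_mono)
        have "\<delta> * k \<le> 1 / 4 * k"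
          using k by (intro mult_right_mono) (auto simp: \<delta>_def)
        with \<eta>m have "ereal (\<eta> * m) \<le> ereal (k / 4) + 0" by simp
        then show ?thesis using lower by (rule order_trans)
      next
        case False
        \<comment> \<open>A tail that is not small already dominates the mean; the smallness was
          measured at radius \<open>2\<rho>\<close>, which costs the factor \<open>2 powr (- a)\<close>.\<close>
        have "ereal (\<delta> * k) \<le> ereal ((\<rho> / R) powr a) * enn2ereal ?T"
        proof (cases ?T)
          case (real T)
          have "(k / 2) powr (p - 1) \<le> (2 * \<rho> / R) powr (s * p) * T powr (p - 1)"
            using False real by (simp add: ennpowr_def not_le flip: ennreal_mult)
          then have "((k / 2) powr (p - 1)) powr (1 / (p - 1))
              \<le> ((2 * \<rho> / R) powr (s * p) * T powr (p - 1)) powr (1 / (p - 1))"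
            using p by (intro powr_mono2) auto
          then have "k / 2 \<le> (2 * \<rho> / R) powr a * T"
            using p k \<rho> R real by (simp add: powr_mult powr_powr a_def)
          also have "(2 * \<rho> / R) powr a = 2 powr a * (\<rho> / R) powr a"
            using \<rho> R powr_mult[of 2 "\<rho> / R" a] by simp
          finally have "2 powr (- a) / 2 * k \<le> (\<rho> / R) powr a * T"
            by (simp add: powr_minus field_simps)
          moreover have "\<delta> * k \<le> 2 powr (- a) / 2 * k"
            using k by (intro mult_right_mono) (auto simp: \<delta>_def)
          ultimately show ?thesis using real by (simp add: enn2ereal_ennreal)
        next
          case top
          then show ?thesis using \<rho> R by (simp add: top_ereal_def)
        qed
        with essinf_0 have lower: "ereal 0 + ereal (\<delta> * k)
            \<le> essinf_on (ball x0 (\<rho> / 2)) u + ereal ((\<rho> / R) powr a) * enn2ereal ?T"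
          by (rule add_mono)
        have "ereal (\<eta> * m) \<le> ereal 0 + ereal (\<delta> * k)" using \<eta>m by simp
        then show ?thesis using lower by (rule order_trans)
      qed
    qed
    then show ?thesis unfolding rhs a_def .
  qed
  with \<eta> show ?thesis by blast
qed

end
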